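(* Let $\tau\in\mathbb R$ and let $\{\lambda_k\}_{k\in\mathbb Z}$ be defined by $\lambda_k=e^{i\tau k^2}$. Then the operator $\mathrm{Conv}_\lambda$ is regular, and for all $m,n\in\mathbb Z$ $$\omega_{m,n}=\delta_{0,m+n}\,\delta_{\tau m,\pi\mathbb Z}\,e^{i\tau m^2},\qquad\delta_{\tau m,\pi\mathbb Z}=\begin{cases}1&\text{if }\tau m/\pi\in\mathbb Z,\\0&\text{if }\tau m/\pi\notin\mathbb Z,\end{cases}$$ where $\delta_{0,m+n}$ is the Kronecker delta.
   Context: $\mathbb T=\mathbb R/2\pi\mathbb Z$ with measure $d\mu=dx/2\pi$. For a bounded sequence $\{\lambda_k\}_{k\in\mathbb Z}$, the convolution operator $\mathrm{Conv}_\lambda$ on $L^2(\mathbb T,\mu)$ is $\sum_kf_ke^{ikx}\mapsto\sum_k\lambda_kf_ke^{ikx}$, i.e. its matrix is $W_{k,j}=\delta_{k,j}\lambda_k$. A bounded operator $W$ on $L^2(\mathbb T,\mu)$ has matrix $(W_{j,k})_{j,k\in\mathbb Z}$: $W\sum_kf_ke^{ikx}=\sum_{j,k}W_{j,k}f_ke^{ijx}$. $W\in\mathcal{DT}(\mathbb T)$ (diagonal type) means $c_k=\sup_j|W_{j+k,j}|<\infty$ for all $k\in\mathbb Z$ and $\sum_{k\in\mathbb Z}c_k<\infty$. $W$ is regular if $W\in\mathcal{DT}(\mathbb T)$ and for all $m,n\in\mathbb Z$ the limit $\omega_{m,n}=\lim_{\#I\to\infty}\frac1{\#I}\sum_{j\in\mathbb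 Z,\,l\in I}W_{l+m,j}\overline{W_{l,j+n}}$ exists, where $I\subset\mathbb Z$ ranges over finite intervals of consecutive integers (limit over all such intervals, irrespective of position, as the number of elements $\#I\to\infty$). *)

theory Defs
  imports "HOL-Analysis.Analysis"
begin

text \<open>
  The circle is represented by its fundamental domain [0, 2 pi): the normalised measure is carried
  by that interval, so the values of a function outside it are irrelevant. Elements of the L2 space
  are represented by functions, with equality almost everywhere in place of a quotient.
\<close>

definition circle_measure :: "real measure" where
  "circle_measure = uniform_measure lborel {0..<2 * pi}"

definition L2 :: "(real \<Rightarrow> complex) set" where
  "L2 = {f \<in> borel_measurable circle_measure. integrable circle_measure (\<lambda>x. (cmod (f x))\<^sup>2)}"

definition L2_norm :: "(real \<Rightarrow> complex) \<Rightarrow> real" where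
  "L2_norm f = sqrt (LINT x|circle_measure. (cmod (f x))\<^sup>2)"

definition expi :: "int \<Rightarrow> real \<Rightarrow> complex" where
  "expi k x = cis (of_int k * x)"

definition fourier_coeff :: "(real \<Rightarrow> complex) \<Rightarrow> int \<Rightarrow> complex" where
  "fourier_coeff f k = (LINT x|circle_measure. f x * cnj (expi k x))"

text \<open>\<open>has_L2_expansion a g\<close>: the series of all \<open>a k * expi k\<close> converges to \<open>g\<close> unconditionally in L2.\<close>

definition has_L2_expansion :: "(int \<Rightarrow> complex) \<Rightarrow> (real \<Rightarrow> complex) \<Rightarrow> bool" where
  "has_L2_expansion a g \<longleftrightarrow> g \<in> L2 \<and>
     ((\<lambda>K. L2_norm (\<lambda>x. g x - (\<Sum>k\<in>K. a k * expi k x))) \<longlongrightarrow> 0) (finite_subsets_at_top UNIV)"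

definition bounded_operator :: "((real \<Rightarrow> complex) \<Rightarrow> real \<Rightarrow> complex) \<Rightarrow> bool" where
  "bounded_operator W \<longleftrightarrow>
     (\<forall>f\<in>L2. W f \<in> L2) \<and>
     (\<forall>f\<in>L2. \<forall>g\<in>L2. (AE x in circle_measure. f x = g x) \<longrightarrow> (AE x in circle_measure. W f x = W g x)) \<and>
     (\<forall>f\<in>L2. \<forall>g\<in>L2. AE x in circle_measure. W (\<lambda>y. f y + g y) x = W f x + W g x) \<and>
     (\<forall>c. \<forall>f\<in>L2. AE x in circle_measure. W (\<lambda>y. c * f y) x = c * W f x) \<and>
     (\<exists>C. \<forall>f\<in>L2. L2_norm (W f) \<le> C * L2_norm f)"

definition matrix_entry :: "((real \<Rightarrow> complex) \<Rightarrow> real \<Rightarrow> complex) \<Rightarrow> int \<Rightarrow> int \<Rightarrow> complex" where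
  "matrix_entry W j k = fourier_coeff (W (expi k)) j"

text \<open>
  For bounded \<open>a\<close> and \<open>f\<close> in L2 the function chosen below exists (Riesz-Fischer) and is unique
  almost everywhere.
\<close>

definition Conv :: "(int \<Rightarrow> complex) \<Rightarrow> (real \<Rightarrow> complex) \<Rightarrow> real \<Rightarrow> complex" where
  "Conv a f = (SOME g. has_L2_expansion (\<lambda>k. a k * fourier_coeff f k) g)"

definition diagonal_type :: "((real \<Rightarrow> complex) \<Rightarrow> real \<Rightarrow> complex) \<Rightarrow> bool" where
  "diagonal_type W \<longleftrightarrow> bounded_operator W \<and>
     (\<forall>k. bdd_above (range (\<lambda>j. cmod (matrix_entry W (j + k) j)))) \<and>
     (\<lambda>k. SUP j. cmod (matrix_entry W (j + k) j)) summable_on UNIV"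

text \<open>
  The limit over finite intervals of integers as their length tends to infinity, uniformly in
  their position.
\<close>

definition long_intervals :: "int set filter" where
  "long_intervals = inf (filtercomap card at_top) (principal {I. \<exists>a b. I = {a..b}})"

text \<open>For \<open>W\<close> of diagonal type the double series below converges absolutely for every finite \<open>I\<close>.\<close>

definition correlation_mean ::
    "((real \<Rightarrow> complex) \<Rightarrow> real \<Rightarrow> complex) \<Rightarrow> int \<Rightarrow> int \<Rightarrow> int set \<Rightarrow> complex" where
  "correlation_mean W m n I =
     1 / of_nat (card I) *
     (\<Sum>\<^sub>\<infinity>(j, l)\<in>UNIV \<times> I. matrix_entry W (l + m) j * cnj (matrix_entry W l (j + n)))"

definition regular :: "((real \<Rightarrow> complex) \<Rightarrow> real \<Rightarrow> complex) \<Rightarrow> bool" where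
  "regular W \<longleftrightarrow> diagonal_type W \<and>
     (\<forall>m n. \<exists>w. (correlation_mean W m n \<longlongrightarrow> w) long_intervals)"

definition omega :: "((real \<Rightarrow> complex) \<Rightarrow> real \<Rightarrow> complex) \<Rightarrow> int \<Rightarrow> int \<Rightarrow> complex" where
  "omega W m n = Lim long_intervals (correlation_mean W m n)"

end

theory Submission
  imports Defs
begin

text \<open>
  The matrix of \<open>Conv lam\<close> is diagonal with entries \<open>lam k\<close>, so in the double sum that defines
  \<open>omega m n\<close> only the terms with \<open>j = l + m\<close> and \<open>l = j + n\<close> survive. There are none unless
  \<open>m + n = 0\<close>, and then the correlation mean is the average over \<open>l\<close> in \<open>I\<close> of
  \<open>lam (l + m) * cnj (lam l)\<close>. As \<open>lam\<close> is the exponential of a quadratic phase, this product is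
  \<open>lam m * cis (2 * \<tau> * m * l)\<close>: a fixed number times a character of the integers. The average of a
  character over an interval is 1 if the character is trivial, that is, if \<open>\<tau> * m / pi\<close> is an
  integer; otherwise the geometric sum is bounded independently of the interval and the average is
  of order \<open>1 / card I\<close>, wherever the interval lies (\<open>mean_cis_long_intervals\<close>).

  Most of the work is to justify the first sentence. \<open>Conv a\<close> is obtained by choice among the
  functions with prescribed Fourier coefficients, so existence and uniqueness of such functions are
  needed. Existence is the Riesz--Fischer theorem (\<open>Riesz_Fischer\<close>), that is, completeness of L2 for
  trigonometric series: the partial sums are Cauchy in L1, hence a subsequence converges almost
  everywhere, and Fatou's lemma turns the pointwise limit into an L2 limit. Its hypothesis, that the
  squares of the coefficients have bounded sums, comes from Bessel's inequality and the boundedness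
  of \<open>a\<close>. Uniqueness holds because L2 limits are unique almost everywhere. Linearity and
  the norm bound of \<open>Conv a\<close> follow from those of the coefficients, and the matrix entries follow by recognising the one-term expansion of
  \<open>a k * expi k\<close> (\<open>matrix_entry_Conv\<close>).
\<close>

section \<open>Square integrable functions on the circle\<close>

text \<open>
  Squared norms rather than norms: they are polynomial in the function, so orthogonality becomes an
  algebraic identity, and the triangle inequality takes the form \<open>sqnorm_add_le\<close>.
\<close>

definition sqnorm :: "(real \<Rightarrow> complex) \<Rightarrow> real" where
  "sqnorm f = (LINT x|circle_measure. (cmod (f x))\<^sup>2)"

abbreviation trig_poly :: "(int \<Rightarrow> complex) \<Rightarrow> int set \<Rightarrow> real \<Rightarrow> complex" where
  "trig_poly a K \<equiv> \<lambda>x. \<Sum>k\<in>K. a k * expi k x"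

lemma sets_circle_measure [simp, measurable_cong]: "sets circle_measure = sets borel"
  by (simp add: circle_measure_def)

lemma emeasure_circle_measure: "emeasure circle_measure (space circle_measure) = 1"
  unfolding circle_measure_def
  by (simp add: ennreal_divide_self)

lemma finite_measure_circle: "finite_measure circle_measure"
  by (rule finite_measureI) (simp add: emeasure_circle_measure)

lemma measure_circle_measure: "measure circle_measure (space circle_measure) = 1"
  by (simp add: measure_def emeasure_circle_measure)

lemma integrable_const_circle [simp]: "integrable circle_measure (\<lambda>x. c :: 'b::{banach, second_countable_topology})"
  by (rule finite_measure.integrable_const[OF finite_measure_circle])

lemma integral_const_circle [simp]:
  "(LINT x|circle_measure. c :: 'b::{banach, second_countable_topology}) = c"
  by (simp add: measure_circle_measure)

lemma prob_circle [simp]: "measure circle_measure UNIV = 1"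
  using measure_circle_measure by (simp add: circle_measure_def)

lemma space_circle_measure [simp]: "space circle_measure = UNIV"
  by (simp add: circle_measure_def)

lemma sqnorm_nonneg [simp]: "sqnorm f \<ge> 0"
  unfolding sqnorm_def by simp

lemma L2_norm_eq: "L2_norm f = sqrt (sqnorm f)"
  by (simp add: L2_norm_def sqnorm_def)

lemma L2_norm_tendsto_0_iff:
  "((\<lambda>K. L2_norm (h K)) \<longlongrightarrow> 0) F \<longleftrightarrow> ((\<lambda>K. sqnorm (h K)) \<longlongrightarrow> 0) F"
proof
  assume "((\<lambda>K. L2_norm (h K)) \<longlongrightarrow> 0) F"
  from tendsto_power[OF this, of 2] show "((\<lambda>K. sqnorm (h K)) \<longlongrightarrow> 0) F"
    by (simp add: L2_norm_eq)
next
  assume "((\<lambda>K. sqnorm (h K)) \<longlongrightarrow> 0) F"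
  from tendsto_real_sqrt[OF this] show "((\<lambda>K. L2_norm (h K)) \<longlongrightarrow> 0) F"
    by (simp add: L2_norm_eq)
qed

lemma expi_measurable [measurable]: "expi k \<in> borel_measurable borel"
  unfolding expi_def[abs_def] cis_conv_exp by measurable

lemma cnj_measurable [measurable]: "cnj \<in> borel_measurable borel"
  by (intro borel_measurable_continuous_onI continuous_intros)

lemma cmod_expi [simp]: "cmod (expi k x) = 1"
  by (simp add: expi_def)

lemma L2_measurable: "f \<in> L2 \<Longrightarrow> f \<in> borel_measurable borel"
  and L2_integrable_square: "f \<in> L2 \<Longrightarrow> integrable circle_measure (\<lambda>x. (cmod (f x))\<^sup>2)"
  by (auto simp: L2_def cong: measurable_cong_sets)

lemma L2_I:
  "f \<in> borel_measurable borel \<Longrightarrow> integrable circle_measure (\<lambda>x. (cmod (f x))\<^sup>2) \<Longrightarrow> f \<in> L2"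
  by (auto simp: L2_def cong: measurable_cong_sets)

lemma cmod_add_square_le: "(cmod (u + v))\<^sup>2 \<le> 2 * (cmod u)\<^sup>2 + 2 * (cmod v)\<^sup>2"
proof -
  have "(cmod (u + v))\<^sup>2 \<le> (cmod u + cmod v)\<^sup>2"
    by (intro power_mono norm_triangle_ineq) auto
  also have "\<dots> \<le> 2 * (cmod u)\<^sup>2 + 2 * (cmod v)\<^sup>2"
    using sum_squares_bound[of "cmod u" "cmod v"] by (simp add: power2_sum)
  finally show ?thesis .
qed

lemma L2_add [intro]:
  assumes "f \<in> L2" "g \<in> L2"
  shows "(\<lambda>x. f x + g x) \<in> L2"
proof (rule L2_I)
  note [measurable] = L2_measurable[OF assms(1)] L2_measurable[OF assms(2)]
  show "(\<lambda>x. f x + g x) \<in> borel_measurable borel" by measurable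
  show "integrable circle_measure (\<lambda>x. (cmod (f x + g x))\<^sup>2)"
  proof (rule Bochner_Integration.integrable_bound)
    show "integrable circle_measure (\<lambda>x. 2 * (cmod (f x))\<^sup>2 + 2 * (cmod (g x))\<^sup>2)"
      using assms[THEN L2_integrable_square] by simp
  qed (use cmod_add_square_le in \<open>auto intro!: AE_I2\<close>)
qed

lemma L2_scale [intro]:
  assumes "f \<in> L2"
  shows "(\<lambda>x. c * f x) \<in> L2"
proof (rule L2_I)
  note [measurable] = L2_measurable[OF assms(1)]
  show "(\<lambda>x. c * f x) \<in> borel_measurable borel" by measurable
qed (use assms[THEN L2_integrable_square] in \<open>simp add: norm_mult power_mult_distrib\<close>)

lemma L2_diff [intro]:
  assumes "f \<in> L2" "g \<in> L2"
  shows "(\<lambda>x. f x - g x) \<in> L2"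
  using L2_add[OF assms(1) L2_scale[OF assms(2), of "-1"]] by simp

lemma L2_expi [intro, simp]: "expi k \<in> L2"
  by (rule L2_I) auto

lemma L2_zero [simp]: "(\<lambda>x. 0) \<in> L2"
  by (rule L2_I) auto

lemma L2_trig_poly [intro, simp]: "trig_poly a K \<in> L2"
  by (induction K rule: infinite_finite_induct) (simp_all add: L2_add L2_scale)

lemma L2_mult_integrable:
  assumes "f \<in> L2" "g \<in> L2"
  shows "integrable circle_measure (\<lambda>x. f x * cnj (g x))"
proof (rule Bochner_Integration.integrable_bound)
  show "integrable circle_measure (\<lambda>x. (cmod (f x))\<^sup>2 + (cmod (g x))\<^sup>2)"
    using assms[THEN L2_integrable_square] by simp
  note [measurable] = L2_measurable[OF assms(1)] L2_measurable[OF assms(2)]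
  show "(\<lambda>x. f x * cnj (g x)) \<in> borel_measurable circle_measure" by measurable
  have "cmod u * cmod v \<le> (cmod u)\<^sup>2 + (cmod v)\<^sup>2" for u v
    using sum_squares_bound[of "cmod u" "cmod v"] mult_nonneg_nonneg[of "cmod u" "cmod v"] norm_ge_zero[of u] norm_ge_zero[of v]
    by linarith
  then show "AE x in circle_measure. norm (f x * cnj (g x)) \<le> norm ((cmod (f x))\<^sup>2 + (cmod (g x))\<^sup>2)"
    by (auto simp: norm_mult)
qed

lemma L2_integrable:
  assumes "f \<in> L2"
  shows "integrable circle_measure f"
  using L2_mult_integrable[OF assms L2_expi[of 0]] by (simp add: expi_def)

lemma sqnorm_add_le:
  assumes "f \<in> L2" "g \<in> L2"
  shows "sqnorm (\<lambda>x. f x + g x) \<le> 2 * sqnorm f + 2 * sqnorm g"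
proof -
  have "sqnorm (\<lambda>x. f x + g x) \<le> (LINT x|circle_measure. 2 * (cmod (f x))\<^sup>2 + 2 * (cmod (g x))\<^sup>2)"
    unfolding sqnorm_def
    by (intro integral_mono L2_integrable_square L2_add assms cmod_add_square_le)
       (use assms[THEN L2_integrable_square] in simp)
  also have "\<dots> = 2 * sqnorm f + 2 * sqnorm g"
    using assms[THEN L2_integrable_square] by (simp add: sqnorm_def)
  finally show ?thesis .
qed

lemma sqnorm_scale: "sqnorm (\<lambda>x. c * f x) = (cmod c)\<^sup>2 * sqnorm f"
  by (simp add: sqnorm_def norm_mult power_mult_distrib)

lemma sqnorm_eq_0_imp_AE:
  assumes "f \<in> L2" "sqnorm f = 0"
  shows "AE x in circle_measure. f x = 0"
  using integral_nonneg_eq_0_iff_AE[OF L2_integrable_square[OF assms(1)]] assms(2)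
  by (simp add: sqnorm_def)

section \<open>Fourier coefficients and Bessel's inequality\<close>

lemma fourier_coeff_add:
  assumes "f \<in> L2" "g \<in> L2"
  shows "fourier_coeff (\<lambda>x. f x + g x) k = fourier_coeff f k + fourier_coeff g k"
  using L2_mult_integrable[OF assms(1) L2_expi] L2_mult_integrable[OF assms(2) L2_expi]
  by (simp add: fourier_coeff_def distrib_right)

lemma fourier_coeff_scale: "fourier_coeff (\<lambda>x. c * f x) k = c * fourier_coeff f k"
  by (simp add: fourier_coeff_def mult.assoc)

lemma fourier_coeff_diff:
  assumes "f \<in> L2" "g \<in> L2"
  shows "fourier_coeff (\<lambda>x. f x - g x) k = fourier_coeff f k - fourier_coeff g k"
  using fourier_coeff_add[OF assms(1) L2_scale[OF assms(2), of "-1"]]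
        fourier_coeff_scale[of "-1" g k] by simp

lemma fourier_coeff_cong_AE:
  assumes "f \<in> L2" "g \<in> L2" "AE x in circle_measure. f x = g x"
  shows "fourier_coeff f k = fourier_coeff g k"
  unfolding fourier_coeff_def
proof (rule integral_cong_AE)
  note [measurable] = L2_measurable[OF assms(1)] L2_measurable[OF assms(2)]
  show "(\<lambda>x. f x * cnj (expi k x)) \<in> borel_measurable circle_measure"
       "(\<lambda>x. g x * cnj (expi k x)) \<in> borel_measurable circle_measure"
    by measurable
qed (use assms(3) in auto)

text \<open>
  The closed interval is the domain to which the fundamental theorem of calculus applies.
\<close>

lemma integral_circle_measure:
  fixes f :: "real \<Rightarrow> complex"
  assumes [measurable]: "f \<in> borel_measurable borel"
  shows "(LINT x|circle_measure. f x) = (LINT x|lborel. indicator {0..2*pi} x *\<^sub>R f x) / (2 * pi)"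
proof -
  have *: "circle_measure = density lborel (\<lambda>x. ennreal (indicator {0..<2*pi} x / (2*pi)))"
    unfolding circle_measure_def uniform_measure_def
    by (intro density_cong) (auto simp: divide_ennreal[of 1, simplified] split: split_indicator intro!: AE_I2)
  have "(LINT x|circle_measure. f x) = (LINT x|lborel. (indicator {0..<2*pi} x / (2*pi)) *\<^sub>R f x)"
    unfolding * by (rule integral_density) auto
  also have "\<dots> = (LINT x|lborel. (indicator {0..2*pi} x *\<^sub>R f x) / (2 * pi))"
    by (intro integral_cong_AE)
       (use AE_lborel_singleton[of "2*pi"] in \<open>auto split: split_indicator simp: scaleR_conv_of_real elim!: eventually_mono\<close>)
  finally show ?thesis by simp
qed

lemma integral_expi_circle: "(LINT x|circle_measure. expi k x) = (if k = 0 then 1 else 0)"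
proof (cases "k = 0")
  case True
  then show ?thesis by (simp add: expi_def)
next
  case False
  define F where "F x = expi k x / (\<i> * of_int k)" for x
  have "(F has_vector_derivative expi k x) (at x within A)" for x A
  proof -
    have "((\<lambda>x. cis (of_int k * x)) has_vector_derivative (of_int k * \<i> * cis (of_int k * x))) (at x within A)"
      unfolding cis_conv_exp
      by (auto intro!: derivative_eq_intros has_vector_derivative_real_field)
    from has_vector_derivative_divide[OF this, of "\<i> * of_int k"] False show ?thesis
      by (simp add: F_def[abs_def] expi_def[abs_def] mult.commute)
  qed
  then have "(LINT x|lborel. indicator {0..2*pi} x *\<^sub>R expi k x) = F (2 * pi) - F 0"
    by (intro integral_FTC_atLeastAtMost) (auto simp: expi_def[abs_def] intro!: continuous_intros)
  also have "\<dots> = 0"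
  proof -
    have "expi k (2 * pi) = 1"
      using cis_multiple_2pi[of "of_int k"] by (simp add: expi_def algebra_simps)
    then show ?thesis by (simp add: F_def expi_def)
  qed
  finally show ?thesis using False by (simp add: integral_circle_measure)
qed

lemma fourier_coeff_expi: "fourier_coeff (expi k) j = (if j = k then 1 else 0)"
proof -
  have "expi k x * cnj (expi j x) = expi (k - j) x" for x
    by (simp add: expi_def cis_cnj cis_mult algebra_simps)
  then show ?thesis by (simp add: fourier_coeff_def integral_expi_circle)
qed

lemma fourier_coeff_trig_poly:
  assumes "finite K"
  shows "fourier_coeff (trig_poly a K) j = (if j \<in> K then a j else 0)"
  using assms
proof (induction K)
  case empty
  then show ?case by (simp add: fourier_coeff_def)
next
  case (insert k K)
  then show ?case
    by (auto simp: fourier_coeff_add L2_scale fourier_coeff_scale fourier_coeff_expi)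
qed

text \<open>
  Expand the square; the last term is constant because \<open>expi k\<close> has modulus 1. Applied once for
  each frequency, this gives the squared distance to every trigonometric polynomial.
\<close>

lemma sqnorm_diff_expi:
  assumes "f \<in> L2"
  shows "sqnorm (\<lambda>x. f x - c * expi k x) = sqnorm f - 2 * Re (cnj c * fourier_coeff f k) + (cmod c)\<^sup>2"
proof -
  note int = L2_mult_integrable[OF assms L2_expi[of k]]
  have "(cmod (f x - c * expi k x))\<^sup>2 =
     (cmod (f x))\<^sup>2 - 2 * Re (cnj c * (f x * cnj (expi k x))) + (cmod c)\<^sup>2" for x
  proof -
    have "(cmod (u - v))\<^sup>2 = (cmod u)\<^sup>2 - 2 * Re (u * cnj v) + (cmod v)\<^sup>2" for u v
      unfolding cmod_power2 by (simp add: power2_eq_square algebra_simps)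
    from this[of "f x" "c * expi k x"] show ?thesis by (simp add: norm_mult mult_ac)
  qed
  moreover have "(LINT x|circle_measure. Re (cnj c * (f x * cnj (expi k x)))) = Re (cnj c * fourier_coeff f k)"
    using int by (simp add: fourier_coeff_def integral_Re del: complex_mult_cnj times_complex.sel)
  ultimately show ?thesis
    using int L2_integrable_square[OF assms]
    by (simp add: sqnorm_def integral_Re del: times_complex.sel)
qed

text \<open>
  Subtracting terms of other frequencies does not change the coefficient at \<open>k\<close>, so the corrections
  of \<open>sqnorm_diff_expi\<close> simply add up. Taking \<open>f = 0\<close> gives Parseval's identity for trigonometric
  polynomials, and \<open>a = fourier_coeff f\<close> gives Bessel's inequality.
\<close>

lemma sqnorm_diff_trig_poly:
  assumes "f \<in> L2" "finite K"
  shows "sqnorm (\<lambda>x. f x - trig_poly a K x) =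
    sqnorm f - 2 * (\<Sum>k\<in>K. Re (cnj (a k) * fourier_coeff f k)) + (\<Sum>k\<in>K. (cmod (a k))\<^sup>2)"
  using assms(2)
proof (induction K)
  case empty
  then show ?case by simp
next
  case (insert k K)
  let ?g = "\<lambda>x. f x - trig_poly a K x"
  have "sqnorm (\<lambda>x. f x - trig_poly a (insert k K) x) = sqnorm (\<lambda>x. ?g x - a k * expi k x)"
    using insert by (simp add: algebra_simps)
  also have "\<dots> = sqnorm ?g - 2 * Re (cnj (a k) * fourier_coeff ?g k) + (cmod (a k))\<^sup>2"
    by (intro sqnorm_diff_expi L2_diff assms L2_trig_poly)
  also have "fourier_coeff ?g k = fourier_coeff f k"
    using insert assms by (simp add: fourier_coeff_diff fourier_coeff_trig_poly)
  finally show ?case using insert by (simp add: algebra_simps)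
qed

lemma sqnorm_trig_poly:
  assumes "finite K"
  shows "sqnorm (trig_poly a K) = (\<Sum>k\<in>K. (cmod (a k))\<^sup>2)"
proof -
  have "sqnorm (trig_poly a K) = sqnorm (\<lambda>x. 0 - trig_poly a K x)" by (simp add: sqnorm_def)
  also have "\<dots> = (\<Sum>k\<in>K. (cmod (a k))\<^sup>2)"
    by (subst sqnorm_diff_trig_poly) (auto simp: assms sqnorm_def fourier_coeff_def)
  finally show ?thesis .
qed

lemma Bessel_inequality:
  assumes "f \<in> L2" "finite K"
  shows "(\<Sum>k\<in>K. (cmod (fourier_coeff f k))\<^sup>2) \<le> sqnorm f"
proof -
  have *: "Re (cnj z * z) = (cmod z)\<^sup>2" for z
    unfolding cmod_power2 by (simp add: power2_eq_square)
  have "0 \<le> sqnorm (\<lambda>x. f x - trig_poly (fourier_coeff f) K x)" by simp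
  then show ?thesis by (simp add: sqnorm_diff_trig_poly assms * del: times_complex.sel)
qed


section \<open>The Riesz--Fischer theorem\<close>

text \<open>
  The variance of \<open>cmod f\<close> under the probability measure \<open>circle_measure\<close> is nonnegative.
\<close>

lemma integral_cmod_le_L2_norm:
  assumes "f \<in> L2"
  shows "(LINT x|circle_measure. cmod (f x)) \<le> L2_norm f"
proof -
  define c where "c = (LINT x|circle_measure. cmod (f x))"
  have int1: "integrable circle_measure (\<lambda>x. cmod (f x))"
    using L2_integrable[OF assms] by simp
  have "0 \<le> (LINT x|circle_measure. (cmod (f x) - c)\<^sup>2)" by simp
  also have "\<dots> = (LINT x|circle_measure. (cmod (f x))\<^sup>2 - 2 * c * cmod (f x) + c\<^sup>2)"
    by (simp add: power2_diff algebra_simps)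
  also have "\<dots> = sqnorm f - c\<^sup>2"
    using int1 L2_integrable_square[OF assms]
    by (simp add: sqnorm_def flip: c_def) (simp add: power2_eq_square)
  finally show ?thesis
    unfolding L2_norm_eq c_def by (simp add: real_le_rsqrt)
qed

lemma L2_Fatou:
  assumes u: "\<And>n. u n \<in> L2" and [measurable]: "g \<in> borel_measurable borel"
    and lim: "AE x in circle_measure. (\<lambda>n. u n x) \<longlonglongrightarrow> g x"
    and le: "\<forall>\<^sub>F n in sequentially. sqnorm (u n) \<le> C"
  shows "g \<in> L2 \<and> sqnorm g \<le> C"
proof -
  note [measurable] = L2_measurable[OF u]
  obtain n where "sqnorm (u n) \<le> C" using eventually_happens[OF le] by auto
  then have C: "C \<ge> 0" using sqnorm_nonneg[of "u n"] by linarith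
  have nn: "(\<integral>\<^sup>+x. ennreal ((cmod (u n x))\<^sup>2) \<partial>circle_measure) = ennreal (sqnorm (u n))" for n
    unfolding sqnorm_def by (intro nn_integral_eq_integral L2_integrable_square u) auto
  have "(\<integral>\<^sup>+x. ennreal ((cmod (g x))\<^sup>2) \<partial>circle_measure)
      = (\<integral>\<^sup>+x. liminf (\<lambda>n. ennreal ((cmod (u n x))\<^sup>2)) \<partial>circle_measure)"
  proof (rule nn_integral_cong_AE)
    show "AE x in circle_measure. ennreal ((cmod (g x))\<^sup>2) = liminf (\<lambda>n. ennreal ((cmod (u n x))\<^sup>2))"
      using lim
    proof eventually_elim
      case (elim x)
      then have "(\<lambda>n. ennreal ((cmod (u n x))\<^sup>2)) \<longlonglongrightarrow> ennreal ((cmod (g x))\<^sup>2)"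
        by (intro tendsto_ennrealI tendsto_intros)
      then show ?case by (metis lim_imp_Liminf sequentially_bot)
    qed
  qed
  also have "\<dots> \<le> liminf (\<lambda>n. \<integral>\<^sup>+x. ennreal ((cmod (u n x))\<^sup>2) \<partial>circle_measure)"
    by (intro nn_integral_liminf) measurable
  also have "\<dots> \<le> ennreal C"
  proof (rule Liminf_le)
    show "\<forall>\<^sub>F n in sequentially. (\<integral>\<^sup>+x. ennreal ((cmod (u n x))\<^sup>2) \<partial>circle_measure) \<le> ennreal C"
      using le by eventually_elim (simp add: nn ennreal_leI)
  qed simp
  finally have *: "(\<integral>\<^sup>+x. ennreal ((cmod (g x))\<^sup>2) \<partial>circle_measure) \<le> ennreal C" .
  have int: "integrable circle_measure (\<lambda>x. (cmod (g x))\<^sup>2)"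
  proof (rule integrableI_bounded)
    have "(\<integral>\<^sup>+x. ennreal (norm ((cmod (g x))\<^sup>2)) \<partial>circle_measure) \<le> ennreal C" using * by simp
    also have "\<dots> < \<infinity>" by simp
    finally show "(\<integral>\<^sup>+x. ennreal (norm ((cmod (g x))\<^sup>2)) \<partial>circle_measure) < \<infinity>" .
  qed measurable
  moreover have "sqnorm g \<le> C"
    using * nn_integral_eq_integral[OF int] C by (simp add: sqnorm_def)
  ultimately show ?thesis by (simp add: L2_I)
qed

lemma has_L2_expansion_iff:
  "has_L2_expansion a g \<longleftrightarrow>
     g \<in> L2 \<and> ((\<lambda>K. sqnorm (\<lambda>x. g x - trig_poly a K x)) \<longlongrightarrow> 0) (finite_subsets_at_top UNIV)"
  unfolding has_L2_expansion_def L2_norm_tendsto_0_iff ..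

text \<open>
  Let \<open>R K\<close> be the part of the sum of all \<open>(cmod (a k))\<^sup>2\<close> that lies outside \<open>K\<close>. By orthogonality it
  bounds the squared distance from the partial sum over \<open>K\<close> to any later one. Along symmetric
  intervals the partial sums are thus Cauchy in L2, hence in L1, and a subsequence converges almost
  everywhere to some \<open>g\<close>. By \<open>L2_Fatou\<close> the bound \<open>R K\<close> passes to \<open>g\<close> for every finite \<open>K\<close>, and this
  is unconditional convergence because \<open>R\<close> tends to 0 along the finite sets.
\<close>

lemma Riesz_Fischer:
  assumes bound: "\<And>K. finite K \<Longrightarrow> (\<Sum>k\<in>K. (cmod (a k))\<^sup>2) \<le> B"
  shows "\<exists>g. has_L2_expansion a g"
proof -
  define S where "S = (\<Sum>\<^sub>\<infinity>k. (cmod (a k))\<^sup>2)"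
  define R where "R K = S - (\<Sum>k\<in>K. (cmod (a k))\<^sup>2)" for K
  have summ: "(\<lambda>k. (cmod (a k))\<^sup>2) summable_on UNIV"
    by (rule nonneg_bdd_above_summable_on) (auto intro!: bdd_aboveI2[of _ _ B] bound)
  have sum_le: "(\<Sum>k\<in>K. (cmod (a k))\<^sup>2) \<le> S" if "finite K" for K
    unfolding S_def using that by (intro finite_sum_le_infsum summ) auto
  have R_tendsto: "(R \<longlongrightarrow> 0) (finite_subsets_at_top UNIV)"
    using tendsto_diff[OF tendsto_const[of S] infsum_tendsto[OF summ]]
    by (simp add: R_def[abs_def] S_def)
  have sqnorm_gap: "sqnorm (\<lambda>x. trig_poly a L x - trig_poly a K x) \<le> R K" if "K \<subseteq> L" "finite L" for K L
  proof -
    have "finite K" using that finite_subset by auto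
    have "trig_poly a L x - trig_poly a K x = trig_poly a (L - K) x" for x
      using that by (simp add: sum_diff)
    then have "sqnorm (\<lambda>x. trig_poly a L x - trig_poly a K x) = (\<Sum>k\<in>L - K. (cmod (a k))\<^sup>2)"
      using that by (simp add: sqnorm_trig_poly)
    also have "\<dots> = (\<Sum>k\<in>L. (cmod (a k))\<^sup>2) - (\<Sum>k\<in>K. (cmod (a k))\<^sup>2)"
      using that by (simp add: sum_diff)
    finally show ?thesis using sum_le[of L] that by (simp add: R_def)
  qed
  \<comment> \<open>Almost everywhere limits need a countable cofinal family of frequency sets.\<close>
  define D where "D n = {- int n..int n}" for n
  have D_mono: "D i \<subseteq> D j" if "i \<le> j" for i j using that by (auto simp: D_def)
  have D_cofinal: "\<exists>N. K \<subseteq> D N" if K: "finite K" for K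
  proof -
    obtain N where N: "\<forall>i\<in>(\<lambda>k. nat \<bar>k\<bar>) ` K. i \<le> N"
      using K by (meson finite_imageI finite_nat_set_iff_bounded_le)
    have "K \<subseteq> D N"
    proof
      fix k assume "k \<in> K"
      then have "nat \<bar>k\<bar> \<le> N" using N by blast
      then show "k \<in> D N" by (auto simp: D_def)
    qed
    then show ?thesis ..
  qed
  define s where "s n = trig_poly a (D n)" for n
  have s_L2: "s n \<in> L2" for n by (simp add: s_def)
  have "\<exists>N. \<forall>i\<ge>N. \<forall>j\<ge>N. (LINT x|circle_measure. norm (s i x - s j x)) < e" if "e > 0" for e
  proof -
    have "\<forall>\<^sub>F K in finite_subsets_at_top UNIV. R K < e\<^sup>2"
      using order_tendstoD(2)[OF R_tendsto, of "e\<^sup>2"] that by simp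
    then obtain K where K: "finite K" "\<And>L. finite L \<Longrightarrow> K \<subseteq> L \<Longrightarrow> R L < e\<^sup>2"
      by (auto simp: eventually_finite_subsets_at_top)
    obtain N where N: "K \<subseteq> D N" using D_cofinal[OF K(1)] by blast
    have small: "(LINT x|circle_measure. norm (s j x - s i x)) < e" if "N \<le> i" "i \<le> j" for i j
    proof -
      have "(LINT x|circle_measure. norm (s j x - s i x)) \<le> sqrt (sqnorm (\<lambda>x. s j x - s i x))"
        unfolding L2_norm_eq[symmetric] by (intro integral_cmod_le_L2_norm L2_diff s_L2)
      also have "\<dots> \<le> sqrt (R (D i))"
        unfolding s_def using D_mono[OF that(2)] by (intro real_sqrt_le_mono sqnorm_gap) (auto simp: D_def)
      also have "\<dots> < sqrt (e\<^sup>2)"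
        using N D_mono[OF that(1)] by (intro real_sqrt_less_mono K) (auto simp: D_def)
      finally show ?thesis using \<open>e > 0\<close> by simp
    qed
    have "(LINT x|circle_measure. norm (s i x - s j x)) < e" if "N \<le> i" "N \<le> j" for i j
      using small[of i j] small[of j i] that by (cases "i \<le> j") (simp_all add: norm_minus_commute)
    then show ?thesis by blast
  qed
  then obtain r where r: "strict_mono r" "AE x in circle_measure. Cauchy (\<lambda>i. s (r i) x)"
    using cauchy_L1_AE_cauchy_subseq[of circle_measure s] s_L2[THEN L2_integrable] by blast
  define g where "g x = lim (\<lambda>i. s (r i) x)" for x
  have lim: "AE x in circle_measure. (\<lambda>i. s (r i) x) \<longlonglongrightarrow> g x"
    using r(2) by eventually_elim (simp add: g_def Cauchy_convergent_iff convergent_LIMSEQ_iff)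
  note [measurable] = L2_measurable[OF s_L2] L2_measurable[OF L2_trig_poly]
  have [measurable]: "g \<in> borel_measurable borel" unfolding g_def[abs_def] by measurable
  have tail: "(\<lambda>x. g x - trig_poly a K x) \<in> L2 \<and> sqnorm (\<lambda>x. g x - trig_poly a K x) \<le> R K"
    if K: "finite K" for K
  proof (rule L2_Fatou[where u = "\<lambda>n x. s (r n) x - trig_poly a K x"])
    show "(\<lambda>x. s (r n) x - trig_poly a K x) \<in> L2" for n
      by (intro L2_diff s_L2 L2_trig_poly)
    show "(\<lambda>x. g x - trig_poly a K x) \<in> borel_measurable borel" by measurable
    show "AE x in circle_measure. (\<lambda>n. s (r n) x - trig_poly a K x) \<longlonglongrightarrow> g x - trig_poly a K x"
      using lim by eventually_elim (intro tendsto_intros)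
    obtain N where N: "K \<subseteq> D N" using D_cofinal[OF K] by blast
    show "\<forall>\<^sub>F n in sequentially. sqnorm (\<lambda>x. s (r n) x - trig_poly a K x) \<le> R K"
      using eventually_ge_at_top[of N]
    proof eventually_elim
      case (elim n)
      then have "N \<le> r n" using seq_suble[OF r(1), of n] by simp
      then show ?case unfolding s_def using N D_mono by (intro sqnorm_gap) (auto simp: D_def)
    qed
  qed
  have "g \<in> L2" using tail[of "{}"] by simp
  moreover have "((\<lambda>K. sqnorm (\<lambda>x. g x - trig_poly a K x)) \<longlongrightarrow> 0) (finite_subsets_at_top UNIV)"
  proof (rule tendsto_sandwich[OF _ _ tendsto_const R_tendsto])
    show "\<forall>\<^sub>F K in finite_subsets_at_top UNIV. sqnorm (\<lambda>x. g x - trig_poly a K x) \<le> R K"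
      using tail by (auto intro: eventually_finite_subsets_at_top_weakI)
  qed simp
  ultimately show ?thesis unfolding has_L2_expansion_iff by blast
qed

section \<open>Linearity and uniqueness of expansions\<close>

lemma has_L2_expansion_L2: "has_L2_expansion a g \<Longrightarrow> g \<in> L2"
  by (simp add: has_L2_expansion_def)

lemma has_L2_expansion_add:
  assumes "has_L2_expansion a f" "has_L2_expansion b g"
  shows "has_L2_expansion (\<lambda>k. a k + b k) (\<lambda>x. f x + g x)"
proof -
  let ?F = "\<lambda>K x. f x - trig_poly a K x" and ?G = "\<lambda>K x. g x - trig_poly b K x"
  let ?H = "\<lambda>K x. f x + g x - trig_poly (\<lambda>k. a k + b k) K x"
  have L2: "f \<in> L2" "g \<in> L2" using assms by (auto dest: has_L2_expansion_L2)
  have "((\<lambda>K. 2 * sqnorm (?F K) + 2 * sqnorm (?G K)) \<longlongrightarrow> 2 * 0 + 2 * 0) (finite_subsets_at_top UNIV)"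
    by (intro tendsto_intros) (use assms in \<open>auto simp: has_L2_expansion_iff\<close>)
  then have lim: "((\<lambda>K. 2 * sqnorm (?F K) + 2 * sqnorm (?G K)) \<longlongrightarrow> 0) (finite_subsets_at_top UNIV)"
    by simp
  have "sqnorm (?H K) \<le> 2 * sqnorm (?F K) + 2 * sqnorm (?G K)" for K
  proof -
    have "?H K = (\<lambda>x. ?F K x + ?G K x)" by (simp add: sum.distrib algebra_simps)
    then show ?thesis using sqnorm_add_le[of "?F K" "?G K"] L2 by (simp add: L2_diff)
  qed
  then have "((\<lambda>K. sqnorm (?H K)) \<longlongrightarrow> 0) (finite_subsets_at_top UNIV)"
    by (intro tendsto_sandwich[OF _ _ tendsto_const lim] always_eventually allI) auto
  then show ?thesis using L2 by (auto simp: has_L2_expansion_iff)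
qed

lemma has_L2_expansion_scale:
  assumes "has_L2_expansion a f"
  shows "has_L2_expansion (\<lambda>k. c * a k) (\<lambda>x. c * f x)"
proof -
  have "(\<lambda>x. c * f x - trig_poly (\<lambda>k. c * a k) K x) = (\<lambda>x. c * (f x - trig_poly a K x))" for K
    by (simp add: sum_distrib_left algebra_simps)
  moreover have "((\<lambda>K. (cmod c)\<^sup>2 * sqnorm (\<lambda>x. f x - trig_poly a K x)) \<longlongrightarrow> 0) (finite_subsets_at_top UNIV)"
    by (intro tendsto_mult_right_zero) (use assms in \<open>simp add: has_L2_expansion_iff\<close>)
  ultimately show ?thesis
    using assms by (auto simp: has_L2_expansion_iff sqnorm_scale)
qed

text \<open>
  The difference of the two functions expands with zero coefficients, so its squared norm is the
  limit of a constant.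
\<close>

lemma has_L2_expansion_unique:
  assumes "has_L2_expansion a f" "has_L2_expansion a g"
  shows "AE x in circle_measure. f x = g x"
proof -
  have "has_L2_expansion (\<lambda>k. a k + (-1) * a k) (\<lambda>x. f x + (-1) * g x)"
    by (intro has_L2_expansion_add has_L2_expansion_scale assms)
  then have "(\<lambda>x. f x - g x) \<in> L2" "sqnorm (\<lambda>x. f x - g x) = 0"
    by (simp_all add: has_L2_expansion_iff tendsto_const_iff)
  from sqnorm_eq_0_imp_AE[OF this] show ?thesis by simp
qed

text \<open>
  Split \<open>g\<close> into a partial sum, whose squared norm is at most \<open>B\<close>, and a remainder that tends to 0;
  the factor 2 comes from \<open>sqnorm_add_le\<close>.
\<close>

lemma has_L2_expansion_sqnorm_le:
  assumes "has_L2_expansion a g"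
    and bound: "\<And>K. finite K \<Longrightarrow> (\<Sum>k\<in>K. (cmod (a k))\<^sup>2) \<le> B"
  shows "sqnorm g \<le> 2 * B"
proof -
  let ?G = "\<lambda>K x. g x - trig_poly a K x"
  have g: "g \<in> L2" using assms by (auto dest: has_L2_expansion_L2)
  have "((\<lambda>K. 2 * sqnorm (?G K) + 2 * B) \<longlongrightarrow> 2 * 0 + 2 * B) (finite_subsets_at_top UNIV)"
    by (intro tendsto_intros) (use assms in \<open>auto simp: has_L2_expansion_iff\<close>)
  moreover have "\<forall>\<^sub>F K in finite_subsets_at_top UNIV. sqnorm g \<le> 2 * sqnorm (?G K) + 2 * B"
  proof (rule eventually_finite_subsets_at_top_weakI)
    fix K :: "int set" assume "finite K"
    have "sqnorm g \<le> 2 * sqnorm (?G K) + 2 * sqnorm (trig_poly a K)"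
      using sqnorm_add_le[of "?G K" "trig_poly a K"] g by (simp add: L2_diff)
    also have "sqnorm (trig_poly a K) \<le> B" using \<open>finite K\<close> by (simp add: sqnorm_trig_poly bound)
    finally show "sqnorm g \<le> 2 * sqnorm (?G K) + 2 * B" by simp
  qed
  ultimately show ?thesis
    using tendsto_lowerbound[of _ _ "finite_subsets_at_top UNIV"] by fastforce
qed

lemma has_L2_expansion_single:
  "has_L2_expansion (\<lambda>j. if j = k then c else 0) (\<lambda>x. c * expi k x)"
proof -
  let ?a = "\<lambda>j. if j = k then c else 0"
  have "\<forall>\<^sub>F K in finite_subsets_at_top UNIV. sqnorm (\<lambda>x. c * expi k x - trig_poly ?a K x) = 0"
    unfolding eventually_finite_subsets_at_top
  proof (intro exI[of _ "{k}"] conjI allI impI)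
    fix K :: "int set" assume K: "finite K \<and> {k} \<subseteq> K \<and> K \<subseteq> UNIV"
    then have "trig_poly ?a K x = c * expi k x" for x
      by (simp add: if_distrib[of "\<lambda>z. z * _"] cong: if_cong)
    then show "sqnorm (\<lambda>x. c * expi k x - trig_poly ?a K x) = 0" by (simp add: sqnorm_def)
  qed auto
  then show ?thesis by (auto simp: has_L2_expansion_iff intro: tendsto_eventually)
qed

section \<open>Convolution operators with bounded symbol\<close>

lemma sum_multiplier_Bessel_le:
  assumes "\<And>k. cmod (a k) \<le> B" "f \<in> L2" "finite K"
  shows "(\<Sum>k\<in>K. (cmod (a k * fourier_coeff f k))\<^sup>2) \<le> B\<^sup>2 * sqnorm f"
proof -
  have "(\<Sum>k\<in>K. (cmod (a k * fourier_coeff f k))\<^sup>2) \<le> (\<Sum>k\<in>K. B\<^sup>2 * (cmod (fourier_coeff f k))\<^sup>2)"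
    unfolding norm_mult power_mult_distrib
    by (intro sum_mono mult_right_mono power_mono assms) auto
  also have "\<dots> \<le> B\<^sup>2 * sqnorm f"
    unfolding sum_distrib_left[symmetric] by (intro mult_left_mono Bessel_inequality assms) auto
  finally show ?thesis .
qed

lemma Conv_expansion:
  assumes "\<And>k. cmod (a k) \<le> B" "f \<in> L2"
  shows "has_L2_expansion (\<lambda>k. a k * fourier_coeff f k) (Conv a f)"
proof -
  have "\<exists>g. has_L2_expansion (\<lambda>k. a k * fourier_coeff f k) g"
    by (rule Riesz_Fischer, rule sum_multiplier_Bessel_le[OF assms])
  then show ?thesis unfolding Conv_def by (rule someI_ex)
qed

text \<open>
  Each property is read off the coefficients and transferred by uniqueness of expansions. Functions
  that agree almost everywhere have the same coefficients, so the choice in \<open>Conv\<close> even assigns them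
  the same image.
\<close>

lemma bounded_operator_Conv:
  assumes bound: "\<And>k. cmod (a k) \<le> B"
  shows "bounded_operator (Conv a)"
  unfolding bounded_operator_def
proof (intro conjI ballI allI impI)
  note exp = Conv_expansion[OF bound]
  show "Conv a f \<in> L2" if "f \<in> L2" for f
    using exp[OF that] by (rule has_L2_expansion_L2)
  show "AE x in circle_measure. Conv a f x = Conv a g x"
    if "f \<in> L2" "g \<in> L2" "AE x in circle_measure. f x = g x" for f g
  proof -
    have "fourier_coeff f = fourier_coeff g"
      using fourier_coeff_cong_AE[OF that] by blast
    then show ?thesis by (simp add: Conv_def)
  qed
  show "AE x in circle_measure. Conv a (\<lambda>y. f y + g y) x = Conv a f x + Conv a g x"
    if "f \<in> L2" "g \<in> L2" for f g
  proof (rule has_L2_expansion_unique)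
    show "has_L2_expansion (\<lambda>k. a k * fourier_coeff f k + a k * fourier_coeff g k) (Conv a (\<lambda>y. f y + g y))"
      using exp[OF L2_add[OF that]] by (simp add: fourier_coeff_add that distrib_left)
    show "has_L2_expansion (\<lambda>k. a k * fourier_coeff f k + a k * fourier_coeff g k) (\<lambda>x. Conv a f x + Conv a g x)"
      by (intro has_L2_expansion_add exp that)
  qed
  show "AE x in circle_measure. Conv a (\<lambda>y. c * f y) x = c * Conv a f x" if "f \<in> L2" for c f
  proof (rule has_L2_expansion_unique)
    show "has_L2_expansion (\<lambda>k. c * (a k * fourier_coeff f k)) (Conv a (\<lambda>y. c * f y))"
      using exp[OF L2_scale[OF that]] by (simp add: fourier_coeff_scale mult.left_commute)
    show "has_L2_expansion (\<lambda>k. c * (a k * fourier_coeff f k)) (\<lambda>x. c * Conv a f x)"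
      by (intro has_L2_expansion_scale exp that)
  qed
  show "\<exists>C. \<forall>f\<in>L2. L2_norm (Conv a f) \<le> C * L2_norm f"
  proof (intro exI ballI)
    fix f :: "real \<Rightarrow> complex" assume f: "f \<in> L2"
    have "sqnorm (Conv a f) \<le> 2 * (B\<^sup>2 * sqnorm f)"
      by (rule has_L2_expansion_sqnorm_le[OF exp[OF f] sum_multiplier_Bessel_le[OF bound f]])
    then have "sqrt (sqnorm (Conv a f)) \<le> sqrt (2 * B\<^sup>2 * sqnorm f)"
      by (intro real_sqrt_le_mono) simp
    then show "L2_norm (Conv a f) \<le> sqrt (2 * B\<^sup>2) * L2_norm f"
      by (simp add: L2_norm_eq real_sqrt_mult)
  qed
qed

lemma matrix_entry_Conv:
  assumes "\<And>k. cmod (a k) \<le> B"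
  shows "matrix_entry (Conv a) j k = (if j = k then a k else 0)"
proof -
  have exp: "has_L2_expansion (\<lambda>j. if j = k then a k else 0) (Conv a (expi k))"
    using Conv_expansion[OF assms L2_expi[of k]]
    by (simp add: fourier_coeff_expi if_distrib[of "\<lambda>z. _ * z"] cong: if_cong)
  have "AE x in circle_measure. Conv a (expi k) x = a k * expi k x"
    by (rule has_L2_expansion_unique[OF exp has_L2_expansion_single])
  then have "fourier_coeff (Conv a (expi k)) j = fourier_coeff (\<lambda>x. a k * expi k x) j"
    by (intro fourier_coeff_cong_AE L2_scale L2_expi has_L2_expansion_L2[OF exp])
  then show ?thesis
    by (simp add: matrix_entry_def fourier_coeff_scale fourier_coeff_expi)
qed

lemma diagonal_type_Conv:
  assumes bound: "\<And>k. cmod (a k) \<le> B"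
  shows "diagonal_type (Conv a)"
  unfolding diagonal_type_def
proof (intro conjI allI)
  show "bounded_operator (Conv a)" by (rule bounded_operator_Conv[OF bound])
  have B: "B \<ge> 0" using bound[of 0] norm_ge_zero[of "a 0"] by linarith
  show "bdd_above (range (\<lambda>j. cmod (matrix_entry (Conv a) (j + k) j)))" for k
    by (rule bdd_aboveI2[of _ _ B]) (auto simp: matrix_entry_Conv[OF bound] bound B)
  have "(SUP j. cmod (matrix_entry (Conv a) (j + k) j)) = 0" if "k \<noteq> 0" for k
    using that by (simp add: matrix_entry_Conv[OF bound])
  then have "(\<lambda>k. SUP j. cmod (matrix_entry (Conv a) (j + k) j)) summable_on UNIV
     \<longleftrightarrow> (\<lambda>k. SUP j. cmod (matrix_entry (Conv a) (j + k) j)) summable_on {0}"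
    by (intro summable_on_cong_neutral) auto
  then show "(\<lambda>k. SUP j. cmod (matrix_entry (Conv a) (j + k) j)) summable_on UNIV"
    by simp
qed

text \<open>
  A nonzero term forces \<open>j = l + m\<close> and \<open>l = j + n\<close>, so the infinite double sum lives on the graph of
  \<open>l \<mapsto> l + m\<close> over the finite set \<open>I\<close>, and vanishes unless \<open>m + n = 0\<close>.
\<close>

lemma correlation_mean_Conv:
  assumes bound: "\<And>k. cmod (a k) \<le> B" and "finite I"
  shows "correlation_mean (Conv a) m n I =
    (if m + n = 0 then (\<Sum>l\<in>I. a (l + m) * cnj (a l)) / of_nat (card I) else 0)"
proof -
  let ?t = "\<lambda>(j, l). matrix_entry (Conv a) (l + m) j * cnj (matrix_entry (Conv a) l (j + n))"
  have "infsum ?t (UNIV \<times> I) = infsum ?t ((\<lambda>l. (l + m, l)) ` I)"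
  proof (rule infsum_cong_neutral)
    have "(j, l) \<in> (\<lambda>l. (l + m, l)) ` I \<longleftrightarrow> l \<in> I \<and> j = l + m" for j l by auto
    then show "?t p = 0" if "p \<in> UNIV \<times> I - (\<lambda>l. (l + m, l)) ` I" for p
      using that by (auto simp: matrix_entry_Conv[OF bound])
  qed auto
  also have "\<dots> = sum ?t ((\<lambda>l. (l + m, l)) ` I)"
    using \<open>finite I\<close> by simp
  also have "\<dots> = (\<Sum>l\<in>I. ?t (l + m, l))"
    by (subst sum.reindex) (auto simp: inj_on_def)
  also have "\<dots> = (if m + n = 0 then \<Sum>l\<in>I. a (l + m) * cnj (a l) else 0)"
    by (auto simp: matrix_entry_Conv[OF bound] add.assoc)
  finally show ?thesis by (simp add: correlation_mean_def)
qed

section \<open>Averages of characters over long intervals\<close>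

text \<open>
  There are integer intervals of every length. Limits along the filter are therefore unique, which
  identifies the value of \<open>Lim\<close> in \<open>omega\<close>.
\<close>

lemma long_intervals_neq_bot: "long_intervals \<noteq> bot"
proof -
  have "\<exists>I :: int set. I \<in> {I. \<exists>a b. I = {a..b}} \<and> N \<le> card I" for N
    by (rule exI[of _ "{1..int N}"]) auto
  then show ?thesis
    unfolding long_intervals_def trivial_limit_def eventually_inf_principal
      eventually_filtercomap eventually_at_top_linorder by blast
qed

text \<open>
  The empty interval also has the form \<open>{a..b}\<close>, but a lower bound on the cardinality excludes it.
\<close>

lemma eventually_long_intervals_I:
  assumes "\<And>a b. a \<le> b \<Longrightarrow> P {a..b}"
  shows "eventually P long_intervals"
proof -
  have "P I" if "1 \<le> card I" "I = {a..b}" for I and a b :: int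
    using that assms[of a b] by (cases "a \<le> b") auto
  then show ?thesis
    unfolding long_intervals_def eventually_inf_principal
      eventually_filtercomap eventually_at_top_linorder by blast
qed

lemma filterlim_card_long_intervals: "filterlim card at_top long_intervals"
  unfolding long_intervals_def by (rule filterlim_mono[OF filterlim_filtercomap order_refl inf_le1])

text \<open>
  Multiplying by \<open>cis \<theta> - 1\<close> makes the geometric sum telescope to a difference of two numbers of
  modulus 1. The bound depends neither on the length nor on the position of the interval.
\<close>

lemma norm_sum_cis_interval_le:
  fixes a b :: int
  assumes "a \<le> b"
  shows "cmod (cis \<theta> - 1) * cmod (\<Sum>l\<in>{a..b}. cis (\<theta> * of_int l)) \<le> 2"
proof -
  have telescope: "(cis \<theta> - 1) * cis (\<theta> * of_int l) = cis (\<theta> * of_int (l + 1)) - cis (\<theta> * of_int l)" for l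
    by (simp add: cis_mult algebra_simps)
  have "(cis \<theta> - 1) * (\<Sum>l\<in>{a..b}. cis (\<theta> * of_int l)) = cis (\<theta> * of_int (b + 1)) - cis (\<theta> * of_int a)"
    using assms
  proof (induction b rule: int_ge_induct)
    case base
    then show ?case by (simp add: telescope)
  next
    case (step b)
    have "{a..b + 1} = insert (b + 1) {a..b}" using step by auto
    then show ?case
      using step.IH telescope[of "b + 1"] by (simp add: distrib_left)
  qed
  moreover have "cmod (cis (\<theta> * of_int (b + 1)) - cis (\<theta> * of_int a)) \<le> 2"
    using norm_triangle_ineq4[of "cis (\<theta> * of_int (b + 1))" "cis (\<theta> * of_int a)"] by simp
  ultimately show ?thesis by (simp flip: norm_mult)
qed

lemma mean_cis_long_intervals:
  "((\<lambda>I. (\<Sum>l\<in>I. cis (\<theta> * of_int l)) / of_nat (card I)) \<longlongrightarrow> (if cis \<theta> = 1 then 1 else 0)) long_intervals"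
proof (cases "cis \<theta> = 1")
  case True
  have "cis (\<theta> * of_int l) = 1" for l
    using True by (metis cis_power_int mult.commute power_int_1_left)
  then have "\<forall>\<^sub>F I in long_intervals. (\<Sum>l\<in>I. cis (\<theta> * of_int l)) / of_nat (card I) = 1"
    by (intro eventually_long_intervals_I) (simp add: card_eq_0_iff del: card_atLeastAtMost_int)
  then show ?thesis using True by (simp add: tendsto_eventually)
next
  case False
  define C where "C = 2 / cmod (cis \<theta> - 1)"
  have "filterlim (\<lambda>I. real (card I)) at_top long_intervals"
    by (rule filterlim_compose[OF filterlim_real_sequentially filterlim_card_long_intervals])
  then have lim: "((\<lambda>I. C / real (card I)) \<longlongrightarrow> 0) long_intervals"
    by (intro real_tendsto_divide_at_top[OF tendsto_const])
  have "((\<lambda>I. (\<Sum>l\<in>I. cis (\<theta> * of_int l)) / of_nat (card I)) \<longlongrightarrow> 0) long_intervals"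
  proof (rule Lim_null_comparison[OF _ lim], rule eventually_long_intervals_I)
    fix a b :: int assume "a \<le> b"
    then have "cmod (\<Sum>l\<in>{a..b}. cis (\<theta> * of_int l)) \<le> C"
      using norm_sum_cis_interval_le[of a b \<theta>] False by (simp add: C_def field_simps)
    then show "norm ((\<Sum>l\<in>{a..b}. cis (\<theta> * of_int l)) / of_nat (card {a..b})) \<le> C / real (card {a..b})"
      by (simp add: norm_divide divide_right_mono)
  qed
  then show ?thesis using False by simp
qed

lemma cis_double_eq_1_iff: "cis (2 * t) = 1 \<longleftrightarrow> t / pi \<in> \<int>"
proof -
  have "cis (2 * t) = 1 \<longleftrightarrow> (\<exists>n::int. 2 * t = of_int (2 * n) * pi)"
    by (simp add: cis_conv_exp exp_eq_1)
  also have "\<dots> \<longleftrightarrow> (\<exists>n::int. t / pi = of_int n)"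
    by (simp add: field_simps)
  finally show ?thesis by (auto simp: Ints_def)
qed

section \<open>Regularity for quadratic phases\<close>

theorem lemma5p2:
  fixes \<tau> :: real and lam :: "int \<Rightarrow> complex"
  assumes "\<And>k. lam k = exp (\<i> * of_real (\<tau> * (of_int k)\<^sup>2))"
  shows "regular (Conv lam) \<and>
    (\<forall>m n. omega (Conv lam) m n =
       (if m + n = 0 then 1 else 0) * (if \<tau> * of_int m / pi \<in> \<int> then 1 else 0) *
       exp (\<i> * of_real (\<tau> * (of_int m)\<^sup>2)))"
proof -
  have lam: "lam k = cis (\<tau> * (of_int k)\<^sup>2)" for k
    by (simp add: assms cis_conv_exp)
  then have bound: "cmod (lam k) \<le> 1" for k by simp
  define w where "w m n = (if m + n = 0 then 1 else 0) * (if \<tau> * of_int m / pi \<in> \<int> then 1 else 0) *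
       exp (\<i> * of_real (\<tau> * (of_int m)\<^sup>2))" for m n :: int
  \<comment> \<open>The difference of the phases \<open>\<tau> * (l + m)\<^sup>2\<close> and \<open>\<tau> * l\<^sup>2\<close> is linear in \<open>l\<close>.\<close>
  have shift: "lam (l + m) * cnj (lam l) = lam m * cis (2 * (\<tau> * of_int m) * of_int l)" for l m
    by (simp add: lam cis_cnj cis_mult power2_eq_square algebra_simps)
  have lim: "(correlation_mean (Conv lam) m n \<longlongrightarrow> w m n) long_intervals" for m n
  proof -
    have "\<forall>\<^sub>F I in long_intervals. (if m + n = 0 then 1 else 0) * (lam m *
        ((\<Sum>l\<in>I. cis (2 * (\<tau> * of_int m) * of_int l)) / of_nat (card I))) = correlation_mean (Conv lam) m n I"
      by (intro eventually_long_intervals_I)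
         (simp add: correlation_mean_Conv[OF bound] shift sum_distrib_left)
    moreover have "((\<lambda>I. (if m + n = 0 then 1 else 0) * (lam m *
        ((\<Sum>l\<in>I. cis (2 * (\<tau> * of_int m) * of_int l)) / of_nat (card I)))) \<longlongrightarrow>
        (if m + n = 0 then 1 else 0) * (lam m * (if cis (2 * (\<tau> * of_int m)) = 1 then 1 else 0))) long_intervals"
      by (intro tendsto_mult tendsto_const mean_cis_long_intervals)
    moreover have "(if m + n = 0 then 1 else 0) * (lam m * (if cis (2 * (\<tau> * of_int m)) = 1 then 1 else 0)) = w m n"
      by (simp add: w_def cis_double_eq_1_iff assms)
    ultimately show ?thesis by (simp add: Lim_transform_eventually)
  qed
  have "omega (Conv lam) m n = w m n" for m n
    unfolding omega_def by (rule tendsto_Lim[OF long_intervals_neq_bot lim])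
  moreover have "regular (Conv lam)"
    unfolding regular_def using diagonal_type_Conv[of lam, OF bound] lim by blast
  ultimately show ?thesis by (simp add: w_def)
qed

end
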